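(* With $c = \frac{\pi}{\sqrt{3}}$ we have the following bounds: $$e^{(c - o(1))\sqrt{\frac{n}{\log n}}} < |A(n)| \le |B(n)| < e^{c\sqrt{n}},$$ where $o(1)$ denotes a quantity tending to $0$ as the positive integer $n$ tends to infinity (so the first inequality is an asymptotic statement: for every $\eta > 0$ one has $|A(n)| > e^{(c-\eta)\sqrt{n/\log n}}$ for all sufficiently large $n$).
   Context: For a positive rational $\alpha$ and a positive integer $n$, an $\alpha$-partition of $n$ is a finite set $\{a_1, \ldots, a_r\}$ of distinct positive integers with $a_1 + \cdots + a_r = n$ and $\frac{1}{a_1} + \cdots + \frac{1}{a_r} = \alpha$. The quantity $n_{\alpha}$ is the smallest positive integer such that for every integer $n \ge n_{\alpha}$ an $\alpha$-partition of $n$ exists (it is known, by a theorem of Graham, that $n_\alpha$ exists for every positive rational $\alpha$). $B(n)$ is the set of all positive rationals $\alpha$ for which an $\alpha$-partition of $n$ exists, and $A(n) \subseteq B(n)$ is the set of all positive rationals $\alpha$ with $n_{\alpha} \le n$. *)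

theory Defs
  imports Complex_Main "HOL-Library.Extended_Nat"
begin

definition is_alpha_partition :: "rat \<Rightarrow> nat \<Rightarrow> nat set \<Rightarrow> bool" where
  "is_alpha_partition \<alpha> n S \<longleftrightarrow>
     finite S \<and> (\<forall>a\<in>S. a > 0) \<and> (\<Sum>a\<in>S. a) = n \<and> (\<Sum>a\<in>S. 1 / of_nat a) = \<alpha>"

definition has_alpha_partition :: "rat \<Rightarrow> nat \<Rightarrow> bool" where
  "has_alpha_partition \<alpha> n \<longleftrightarrow> (\<exists>S. is_alpha_partition \<alpha> n S)"

(* The values lie in enat so that the infimum is total: it is the least element of the
   set when the set is nonempty (for every positive rational, by Graham's theorem),
   and infinity otherwise. *)
definition n_alpha :: "rat \<Rightarrow> enat" where
  "n_alpha \<alpha> = Inf {enat N | N. N > 0 \<and> (\<forall>n\<ge>N. has_alpha_partition \<alpha> n)}"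

definition A :: "nat \<Rightarrow> rat set" where
  "A n = {\<alpha>. \<alpha> > 0 \<and> n_alpha \<alpha> \<le> enat n}"

definition B :: "nat \<Rightarrow> rat set" where
  "B n = {\<alpha>. \<alpha> > 0 \<and> has_alpha_partition \<alpha> n}"

(* The next two facts ensure that card is the true cardinality of A n and B n. *)
lemma A_subset_B: "A n \<subseteq> B n"
proof
  fix \<alpha> assume a: "\<alpha> \<in> A n"
  let ?X = "{enat N | N. N > 0 \<and> (\<forall>n\<ge>N. has_alpha_partition \<alpha> n)}"
  from a have pos: "\<alpha> > 0" and le: "Inf ?X \<le> enat n"
    by (auto simp: A_def n_alpha_def)
  have "Inf ?X < enat (Suc n)"
    by (rule le_less_trans[OF le]) simp
  then obtain N where "\<forall>n\<ge>N. has_alpha_partition \<alpha> n" "N < Suc n"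
    by (auto simp: Inf_less_iff)
  with pos show "\<alpha> \<in> B n" by (auto simp: B_def)
qed

lemma finite_B: "finite (B n)"
proof (rule finite_subset)
  show "B n \<subseteq> (\<lambda>S. \<Sum>a\<in>S. 1 / of_nat a) ` Pow {..n}"
  proof
    fix \<alpha> assume "\<alpha> \<in> B n"
    then obtain S where S: "is_alpha_partition \<alpha> n S"
      by (auto simp: B_def has_alpha_partition_def)
    have "a \<le> n" if "a \<in> S" for a
      using S that member_le_sum[of a S "\<lambda>a. a"] by (auto simp: is_alpha_partition_def)
    then show "\<alpha> \<in> (\<lambda>S. \<Sum>a\<in>S. 1 / of_nat a) ` Pow {..n}"
      using S by (auto simp: is_alpha_partition_def)
  qed
qed simp

end

(* Upper bound: |B(n)| is at most the number q(n) of partitions of n into distinct parts, and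
   q(n) x^n < (1 + x)(1 + x^2)... <= 1/((1 - x)(1 - x^3)(1 - x^5)...) for 0 < x < 1. With x = exp(-t)
   the logarithm of the right-hand side is the sum over m of 1/(2 m sinh(mt)), which is at most
   pi^2/(12 t); take t = pi/(2 sqrt(3n)).

   Lower bound: for some fixed rational beta and some K, every sufficiently large integer has a
   beta-partition into K-smooth integers. Adjoining to it a set T of integers p and 2p, with p > K
   prime, gives alpha-partitions for alpha = beta + (sum of the reciprocals of T), where alpha
   determines T. Hence |A(n)| is at least the number of such T whose sum is at most n - O(1). When
   p runs over the first M primes above K, half of the 4^M sets T have at most half of the total
   sum, and Chebyshev's bound pi(x) >= (log 2 - o(1)) x / log x lets M be as large as
   (4/3) sqrt(n / log n), which suffices as (4/3) log 4 > pi / sqrt 3. *)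

theory Submission
  imports Defs "HOL-Analysis.Analysis" "HOL-Computational_Algebra.Primes" "HOL-Real_Asymp.Real_Asymp"
begin

section \<open>The upper bound\<close>

lemma card_B_le: "card (B n) \<le> card {S. S \<subseteq> {1..n} \<and> \<Sum>S = n}"
proof (rule surj_card_le)
  show "finite {S. S \<subseteq> {1..n} \<and> \<Sum>S = n}" by simp
  show "B n \<subseteq> (\<lambda>S. \<Sum>a\<in>S. 1 / of_nat a) ` {S. S \<subseteq> {1..n} \<and> \<Sum>S = n}"
  proof
    fix \<alpha> assume "\<alpha> \<in> B n"
    then obtain S where S: "finite S" "\<forall>a\<in>S. a > 0" "\<Sum>S = n" "(\<Sum>a\<in>S. 1 / of_nat a) = \<alpha>"
      by (auto simp: B_def has_alpha_partition_def is_alpha_partition_def)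
    have "a \<le> n" if "a \<in> S" for a
      using S that member_le_sum[of a S "\<lambda>a. a"] by auto
    then have "S \<subseteq> {1..n}" using S by (auto simp: Suc_le_eq)
    then show "\<alpha> \<in> (\<lambda>S. \<Sum>a\<in>S. 1 / of_nat a) ` {S. S \<subseteq> {1..n} \<and> \<Sum>S = n}"
      using S by blast
  qed
qed

section \<open>Generating function of partitions into distinct parts\<close>

lemma prod_one_plus_power_eq:
  "(\<Prod>k=1..n. 1 + x ^ k) = (\<Sum>S\<in>Pow {1..n}. x ^ \<Sum>S)" for x :: real
proof -
  have "(\<Prod>k=1..n. 1 + x ^ k) = (\<Prod>k\<in>{1..n}. x ^ k + 1)"
    by (simp add: add.commute)
  also have "\<dots> = (\<Sum>S\<in>Pow {1..n}. x ^ \<Sum>S)"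
    by (subst prod_add) (simp_all add: power_sum)
  finally show ?thesis .
qed

lemma card_times_power_less_prod:
  fixes x :: real
  assumes "0 < x" "n > 0"
  shows "real (card {S. S \<subseteq> {1..n} \<and> \<Sum>S = n}) * x ^ n < (\<Prod>k=1..n. 1 + x ^ k)"
proof -
  let ?Q = "{S. S \<subseteq> {1..n} \<and> \<Sum>S = n}"
  have "real (card ?Q) * x ^ n = (\<Sum>S\<in>?Q. x ^ \<Sum>S)" by simp
  also have "\<dots> < (\<Sum>S\<in>Pow {1..n}. x ^ \<Sum>S)"
    \<comment> \<open>The empty set has sum 0, not \<open>n\<close>; its extra term 1 makes the
      inequality strict.\<close>
    using assms by (intro sum_strict_mono2[where b = "{}"]) auto
  finally show ?thesis by (simp only: prod_one_plus_power_eq)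
qed

text \<open>A finite form of Euler's passage from distinct to odd parts. Multiplying the left-hand
  product by \<open>D n\<close> gives the factors of \<open>D (2 * n)\<close> with even exponent,
  and the odd ones complete it. Finally \<open>D (2 * n) \<le> D n\<close>, because the factors with
  index above \<open>n\<close> lie between 0 and 1.\<close>

lemma prod_one_plus_power_le:
  fixes x :: real
  assumes x: "0 < x" "x < 1"
  shows "(\<Prod>k=1..n. 1 + x ^ k) \<le> (\<Prod>j<n. 1 / (1 - x ^ (2 * j + 1)))"
proof -
  have less: "x ^ k < 1" if "k > 0" for k using x that by (simp add: power_less_one_iff)
  define D where "D m = (\<Prod>k=1..m. 1 - x ^ k)" for m
  have split: "D (2 * n) = (\<Prod>k=1..n. 1 - x ^ (2 * k)) * (\<Prod>j<n. 1 - x ^ (2 * j + 1))" for n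
    by (induction n) (simp_all add: D_def algebra_simps)
  have double: "(\<Prod>k=1..n. 1 + x ^ k) * D n = (\<Prod>k=1..n. 1 - x ^ (2 * k))"
    unfolding D_def by (subst prod.distrib[symmetric])
      (intro prod.cong, auto simp: algebra_simps power_mult power2_eq_square simp flip: power_mult_distrib)
  have "(\<Prod>k=1..n. 1 + x ^ k) * (\<Prod>j<n. 1 - x ^ (2 * j + 1)) * D n
      = (\<Prod>k=1..n. 1 + x ^ k) * D n * (\<Prod>j<n. 1 - x ^ (2 * j + 1))"
    by (simp only: ac_simps)
  also have "\<dots> = D (2 * n)"
    by (simp only: double split)
  also have "\<dots> \<le> D n"
  proof -
    have "{1..2 * n} = {1..n} \<union> {n+1..2 * n}" by auto
    then have "D (2 * n) = D n * (\<Prod>k=n+1..2 * n. 1 - x ^ k)"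
      unfolding D_def by (simp add: prod.union_disjoint)
    moreover have "(\<Prod>k=n+1..2 * n. 1 - x ^ k) \<le> 1"
      using x by (intro prod_le_1) (auto intro: power_le_one)
    moreover have "D n \<ge> 0" using x unfolding D_def by (intro prod_nonneg) (auto intro: power_le_one)
    ultimately show ?thesis by (simp add: mult_left_le)
  qed
  finally have "(\<Prod>k=1..n. 1 + x ^ k) * (\<Prod>j<n. 1 - x ^ (2 * j + 1)) * D n \<le> 1 * D n" by simp
  moreover have "D n > 0" unfolding D_def using less by (intro prod_pos) auto
  ultimately have "(\<Prod>k=1..n. 1 + x ^ k) * (\<Prod>j<n. 1 - x ^ (2 * j + 1)) \<le> 1"
    by (simp only: mult_le_cancel_right_pos)
  moreover have "(\<Prod>j<n. 1 - x ^ (2 * j + 1)) > 0"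
    using less by (intro prod_pos ballI) (simp only: diff_gt_0_iff_gt)
  ultimately show ?thesis by (simp add: prod_dividef field_simps)
qed

lemma le_sinh: "0 \<le> x \<Longrightarrow> x \<le> sinh x" for x :: real
proof -
  assume "0 \<le> x"
  then have "sinh 0 - 0 \<le> sinh x - x"
    by (intro DERIV_nonneg_imp_nondecreasing[of 0 x "\<lambda>x. sinh x - x"])
      (auto intro!: exI derivative_eq_intros cosh_real_ge_1)
  then show ?thesis by simp
qed

text \<open>A geometric progression: with \<open>y = exp (- (t * real m))\<close> the sum is at most
  y / (1 - y^2) = 1 / (2 sinh (t m)), and sinh x \<ge> x for x \<ge> 0.\<close>

lemma sum_odd_powers_le:
  fixes t :: real
  assumes t: "t > 0" and m: "m > 0"
  shows "(\<Sum>j<n. (exp (- t) ^ (2 * j + 1)) ^ m) \<le> 1 / (2 * (t * real m))"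
proof -
  define y where "y = exp (- (t * real m))"
  have y: "0 < y" "y < 1" "y ^ 2 < 1" using t m by (auto simp: y_def power_less_one_iff)
  have "(\<Sum>j<n. (exp (- t) ^ (2 * j + 1)) ^ m) = (\<Sum>j<n. y * (y ^ 2) ^ j)"
  proof (intro sum.cong refl)
    fix j
    have "exp (- t) ^ m = y" by (simp add: y_def mult.commute flip: exp_of_nat_mult)
    then show "(exp (- t) ^ (2 * j + 1)) ^ m = y * (y ^ 2) ^ j"
      by (metis Suc_eq_plus1 mult.commute power_Suc power_mult)
  qed
  also have "\<dots> = y * ((1 - (y ^ 2) ^ n) / (1 - y ^ 2))"
    using y sum_gp_strict[of "y ^ 2" n] by (simp flip: sum_distrib_left)
  also have "\<dots> \<le> y * (1 / (1 - y ^ 2))"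
    using y by (intro mult_left_mono divide_right_mono) auto
  also have "\<dots> = 1 / (2 * sinh (t * real m))"
  proof -
    have "exp (t * real m) = 1 / y" by (simp add: y_def exp_minus inverse_eq_divide)
    then have "2 * sinh (t * real m) = 1 / y - y" by (simp add: sinh_def y_def)
    also have "\<dots> = (1 - y ^ 2) / y" using y by (simp add: field_simps power2_eq_square)
    finally show ?thesis by simp
  qed
  also have "\<dots> \<le> 1 / (2 * (t * real m))"
    using le_sinh[of "t * real m"] t m by (intro divide_left_mono) auto
  finally show ?thesis .
qed

text \<open>Each - ln (1 - y j) is expanded in powers of \<open>y j\<close>. Summing over
  \<open>j\<close> first, \<open>sum_odd_powers_le\<close> bounds the m-th term by 1 / (2 t m^2),
  and the sum of the inverse squares is pi^2 / 6.\<close>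

lemma prod_inverse_odd_le:
  fixes t :: real
  assumes t: "t > 0"
  shows "(\<Prod>j<n. 1 / (1 - exp (- t) ^ (2 * j + 1))) \<le> exp (pi\<^sup>2 / (12 * t))"
proof -
  define y where "y j = exp (- t) ^ (2 * j + 1)" for j :: nat
  have y: "0 < y j" "y j < 1" for j
    using t by (auto simp: y_def power_less_one_iff simp del: power_Suc)
  \<comment> \<open>The series start at \<open>m = 0\<close>, where the terms are 0 because division
    by zero yields 0.\<close>
  have "(\<lambda>m. y j ^ m / real m) sums - ln (1 - y j)" for j
    using sums_minus[OF ln_series'[of "- y j"]] y[of j] by simp
  then have s1: "(\<lambda>m. \<Sum>j<n. y j ^ m / real m) sums (\<Sum>j<n. - ln (1 - y j))"
    by (intro sums_sum)
  have s2: "(\<lambda>m. 1 / (2 * t) * (1 / (real m) ^ 2)) sums (1 / (2 * t) * (pi\<^sup>2 / 6))"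
    using inverse_squares_sums sums_Suc_iff[of "\<lambda>m. 1 / (real m)\<^sup>2" "pi\<^sup>2 / 6"]
    by (intro sums_mult) (simp add: add.commute)
  have "(\<Sum>j<n. y j ^ m / real m) \<le> 1 / (2 * t) * (1 / (real m) ^ 2)" for m
  proof (cases "m = 0")
    case False
    have "(\<Sum>j<n. y j ^ m / real m) = (\<Sum>j<n. y j ^ m) / real m" by (simp add: sum_divide_distrib)
    also have "\<dots> \<le> 1 / (2 * (t * real m)) / real m"
      unfolding y_def using t False by (intro divide_right_mono sum_odd_powers_le) auto
    finally show ?thesis by (simp add: power2_eq_square)
  qed auto
  then have "(\<Sum>j<n. - ln (1 - y j)) \<le> 1 / (2 * t) * (pi\<^sup>2 / 6)"
    using s1 s2 by (rule sums_le)
  then have "exp (\<Sum>j<n. - ln (1 - y j)) \<le> exp (pi\<^sup>2 / (12 * t))" by simp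
  also have "exp (\<Sum>j<n. - ln (1 - y j)) = (\<Prod>j<n. 1 / (1 - y j))"
    using y by (simp add: exp_sum exp_minus inverse_eq_divide)
  finally show ?thesis by (simp add: y_def)
qed

lemma card_B_less:
  assumes n: "n > 0"
  shows "real (card (B n)) < exp (pi / sqrt 3 * sqrt (real n))"
proof -
  let ?q = "card {S. S \<subseteq> {1..n} \<and> \<Sum>S = n}"
  \<comment> \<open>This value minimises the exponent pi^2 / (12 t) + n t by making its two terms
    equal.\<close>
  define t where "t = pi / (2 * sqrt (3 * real n))"
  have t: "t > 0" using n by (simp add: t_def)
  have "real ?q * exp (- t) ^ n < (\<Prod>k=1..n. 1 + exp (- t) ^ k)"
    using n by (intro card_times_power_less_prod) auto
  also have "\<dots> \<le> (\<Prod>j<n. 1 / (1 - exp (- t) ^ (2 * j + 1)))"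
    using t by (intro prod_one_plus_power_le) auto
  also have "\<dots> \<le> exp (pi\<^sup>2 / (12 * t))" by (rule prod_inverse_odd_le[OF t])
  finally have "real ?q * exp (- t) ^ n < exp (pi\<^sup>2 / (12 * t))" .
  then have "real ?q < exp (pi\<^sup>2 / (12 * t)) * exp (real n * t)"
    by (simp add: exp_minus field_simps flip: exp_of_nat_mult)
  also have "\<dots> = exp (pi\<^sup>2 / (12 * t) + real n * t)" by (simp add: exp_add)
  also have "pi\<^sup>2 / (12 * t) + real n * t = pi / sqrt 3 * sqrt (real n)"
  proof -
    define s where "s = sqrt (real n)"
    have s: "s > 0" "real n = s ^ 2" using n by (auto simp: s_def)
    have 3: "sqrt 3 * sqrt 3 = (3::real)" by simp
    have ts: "t = pi / (2 * sqrt 3 * s)" by (simp add: t_def s_def real_sqrt_mult)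
    have "pi\<^sup>2 / (12 * t) = pi * s * sqrt 3 / 6" using s by (simp add: ts power2_eq_square)
    also have "\<dots> = pi * s / (2 * sqrt 3)" using 3 by (simp add: field_simps)
    finally have "pi\<^sup>2 / (12 * t) = pi * s / (2 * sqrt 3)" .
    moreover have "real n * t = pi * s / (2 * sqrt 3)" using s by (simp add: ts power2_eq_square)
    ultimately show ?thesis by (simp add: s_def)
  qed
  finally have "real ?q < exp (pi / sqrt 3 * sqrt (real n))" .
  moreover have "real (card (B n)) \<le> real ?q" using card_B_le by simp
  ultimately show ?thesis by linarith
qed

section \<open>Partitions into smooth numbers\<close>

definition recip :: "nat set \<Rightarrow> rat" where
  "recip S = (\<Sum>a\<in>S. 1 / of_nat a)"

text \<open>Such an \<open>X\<close> supplies the digits of the recursion below: the sum varies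
  while the reciprocal sum stays fixed. The interval has \<open>d + 1\<close> elements, so it meets
  all residues modulo \<open>q\<close> once \<open>d + 1 \<ge> q\<close>.\<close>

definition spans :: "nat set \<Rightarrow> rat \<Rightarrow> nat \<Rightarrow> nat \<Rightarrow> bool" where
  "spans X r l d \<longleftrightarrow> (\<forall>m\<in>{l..l + d}. \<exists>S\<subseteq>X. recip S = r \<and> \<Sum>S = m)"

lemma recip_union_disjoint:
  "finite S \<Longrightarrow> finite T \<Longrightarrow> S \<inter> T = {} \<Longrightarrow> recip (S \<union> T) = recip S + recip T"
  unfolding recip_def by (rule sum.union_disjoint)

lemma recip_times: "k > 0 \<Longrightarrow> recip ((*) k ` S) = recip S / of_nat k"
  by (simp add: recip_def sum.reindex inj_on_def sum_divide_distrib mult.commute)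

lemma sum_times: "k > 0 \<Longrightarrow> \<Sum>((*) k ` S) = k * \<Sum>S" for k :: nat
  by (simp add: sum.reindex inj_on_def sum_distrib_left)

lemma is_alpha_partition_recip:
  "is_alpha_partition \<alpha> n S \<longleftrightarrow> finite S \<and> 0 \<notin> S \<and> \<Sum>S = n \<and> recip S = \<alpha>"
  by (auto simp: is_alpha_partition_def recip_def intro!: Nat.gr0I)

text \<open>Adjoining \<open>U\<close> or \<open>V\<close> adds the same reciprocal sum but shifts
  the interval of attained sums by different amounts. The bounds on \<open>\<Sum>V\<close> make the
  two shifted intervals overlap or abut, so their union is again an interval.\<close>

lemma spans_exchange:
  assumes sp: "spans X r l d" and fin: "finite X" "finite U" "finite V"
    and dis: "X \<inter> (U \<union> V) = {}"
    and eq: "recip V = recip U" and sum: "\<Sum>U \<le> \<Sum>V" "\<Sum>V \<le> \<Sum>U + d + 1"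
  shows "spans (X \<union> (U \<union> V)) (recip U + r) (\<Sum>U + l) ((\<Sum>V - \<Sum>U) + d)"
  unfolding spans_def
proof
  fix m assume m: "m \<in> {\<Sum>U + l..\<Sum>U + l + ((\<Sum>V - \<Sum>U) + d)}"
  have ext: "\<exists>S\<subseteq>X \<union> (U \<union> V). recip S = recip U + r \<and> \<Sum>S = m"
    if W: "W = U \<or> W = V" and mW: "m - \<Sum>W \<in> {l..l + d}" "m \<ge> \<Sum>W" for W
  proof -
    obtain S where S: "S \<subseteq> X" "recip S = r" "\<Sum>S = m - \<Sum>W"
      using sp mW unfolding spans_def by blast
    have fS: "finite S" "finite W" and d: "W \<inter> S = {}"
      using S fin dis W finite_subset by auto
    have "recip (W \<union> S) = recip U + r" "\<Sum>(W \<union> S) = m"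
      using recip_union_disjoint[OF fS(2,1) d] sum.union_disjoint[OF fS(2,1) d, of "\<lambda>x. x"] W eq S mW
      by auto
    then show ?thesis using S W by (intro exI[of _ "W \<union> S"]) auto
  qed
  show "\<exists>S\<subseteq>X \<union> (U \<union> V). recip S = recip U + r \<and> \<Sum>S = m"
  proof (cases "m \<le> \<Sum>U + l + d")
    case True
    then show ?thesis using m by (intro ext[of U]) auto
  next
    case False
    then show ?thesis using m sum by (intro ext[of V]) auto
  qed
qed

section \<open>Exchanges given by explicit lists\<close>

text \<open>A pair \<open>(us, vs)\<close> stands for the choice between two sets with the same
  reciprocal sum; the tail of a list is built up first. Lists instead of sets let the simplifier
  evaluate every condition on explicit data, and distinctness of the support expresses all the
  disjointness at once.\<close>

fun support :: "(nat list \<times> nat list) list \<Rightarrow> nat list" where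
  "support [] = []"
| "support ((us, vs) # gs) = us @ vs @ support gs"

fun low :: "(nat list \<times> nat list) list \<Rightarrow> nat" where
  "low [] = 0"
| "low ((us, vs) # gs) = sum_list us + low gs"

fun width :: "(nat list \<times> nat list) list \<Rightarrow> nat" where
  "width [] = 0"
| "width ((us, vs) # gs) = (sum_list vs - sum_list us) + width gs"

fun chain :: "(nat list \<times> nat list) list \<Rightarrow> bool" where
  "chain [] = True"
| "chain ((us, vs) # gs) \<longleftrightarrow> chain gs
     \<and> sum_list us \<le> sum_list vs \<and> sum_list vs \<le> sum_list us + width gs + 1
     \<and> (\<Sum>a\<leftarrow>vs. 1 / of_nat a :: rat) = (\<Sum>a\<leftarrow>us. 1 / of_nat a)"

text \<open>Iterates \<open>spans_exchange\<close>, starting from the empty set, which attains the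
  sum 0 with reciprocal sum 0.\<close>

lemma spans_chain:
  assumes "chain gs" "distinct (support gs)"
  shows "\<exists>r\<ge>0. spans (set (support gs)) r (low gs) (width gs)"
  using assms
proof (induction gs rule: support.induct)
  case 1
  have "recip {} = 0" by (simp add: recip_def)
  then show ?case by (auto simp: spans_def)
next
  case (2 us vs gs)
  then obtain r where r: "r \<ge> 0" "spans (set (support gs)) r (low gs) (width gs)"
    by auto
  have d: "distinct us" "distinct vs" using 2 by auto
  have s: "\<Sum>(set us) = sum_list us" "\<Sum>(set vs) = sum_list vs"
    using d by (simp_all add: sum_list_distinct_conv_sum_set[of _ "\<lambda>x. x", simplified])
  have rc: "recip (set vs) = recip (set us)"
    using 2 d by (simp add: recip_def sum_list_distinct_conv_sum_set)
  have "recip (set us) \<ge> 0" by (simp add: recip_def sum_nonneg)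
  moreover have "spans (set (support gs) \<union> (set us \<union> set vs)) (recip (set us) + r)
      (\<Sum>(set us) + low gs) ((\<Sum>(set vs) - \<Sum>(set us)) + width gs)"
    using 2 s by (intro spans_exchange[OF r(2)] rc) auto
  moreover have "set (support gs) \<union> (set us \<union> set vs) = set (support ((us, vs) # gs))"
    by auto
  ultimately show ?case using r(1) s
    by (intro exI[of _ "recip (set us) + r"]) (simp only: low.simps width.simps, simp)
qed

definition smooth :: "nat \<Rightarrow> nat set \<Rightarrow> bool" where
  "smooth K S \<longleftrightarrow> (\<forall>a\<in>S. \<forall>p. prime p \<longrightarrow> p dvd a \<longrightarrow> p \<le> K)"

lemma smooth_union: "smooth K S \<Longrightarrow> smooth K T \<Longrightarrow> smooth K (S \<union> T)"
  unfolding smooth_def by auto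

lemma smooth_times: "smooth K S \<Longrightarrow> 0 < k \<Longrightarrow> k \<le> K \<Longrightarrow> smooth K ((*) k ` S)"
  unfolding smooth_def by (auto simp: prime_dvd_mult_iff dest: dvd_imp_le)

lemma smooth_atMost: "S \<subseteq> {0<..K} \<Longrightarrow> smooth K S"
  unfolding smooth_def by (meson dvd_imp_le greaterThanAtMost_iff le_trans subsetD)

text \<open>Prefixing the base-\<open>q\<close> digit \<open>E\<close> to \<open>S\<close>, i.e. passing to \<open>E \<union> qS\<close>, preserves the reciprocal
  sum \<open>rq/(q-1)\<close>, and sends the sum \<open>n\<close> of \<open>S\<close> to \<open>qn + e\<close>, where \<open>e\<close> can have any residue
  modulo \<open>q\<close>. The recursion starts from the sets \<open>E \<union> (q-1)E'\<close>.\<close>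
lemma smooth_partitions_of_spans:
  fixes q :: nat
  assumes sp: "spans X r l d" and fin: "finite X" and X0: "0 \<notin> X" and q: "q \<ge> 2"
    and ndvd: "\<And>x. x \<in> X \<Longrightarrow> \<not> q dvd x" and dis: "\<And>x. x \<in> X \<Longrightarrow> (q - 1) * x \<notin> X"
    and l: "l > 0" and d: "(q + 1) * l + q \<le> d" and K: "q \<le> K" "X \<subseteq> {..K}"
    and N: "N \<ge> q * l"
  shows "\<exists>S. is_alpha_partition (r * of_nat q / of_nat (q - 1)) N S \<and> smooth K S"
  using N
proof (induction N rule: less_induct)
  case (less N)
  have digit: "\<exists>S\<subseteq>X. recip S = r \<and> \<Sum>S = m" if "m \<in> {l..l+d}" for m
    using sp that unfolding spans_def by blast
  have smX: "smooth K S" if "S \<subseteq> X" for S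
    using that K X0 by (intro smooth_atMost subsetI) (metis atMost_iff greaterThanAtMost_iff gr0I subsetD)
  define q' where "q' = q - 1"
  have q': "q = q' + 1" "q' > 0" using q by (auto simp: q'_def)
  show ?case
  proof (cases "N \<le> q * (l + d)")
    case True
    \<comment> \<open>\<open>N\<close> is split as the sum of \<open>S\<close> plus
      \<open>q'\<close> times the sum of \<open>T\<close>. Here \<open>e'\<close> is the largest sum
      available for \<open>T\<close> that leaves at least \<open>l\<close> for
      \<open>S\<close>.\<close>
    define e' where "e' = min ((N - l) div q') (l + d)"
    have Nl: "N \<ge> l + q' * l" using less.prems q' by simp
    have e'1: "e' \<ge> l"
      using Nl q'(2) by (auto simp: e'_def less_eq_div_iff_mult_less_eq mult.commute)
    have "q' * e' \<le> q' * ((N - l) div q')" by (simp add: e'_def)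
    then have e'2: "q' * e' \<le> N - l" by (meson le_trans times_div_less_eq_dividend)
    \<comment> \<open>What is left for \<open>S\<close> is not too large either: rounding down loses
      less than \<open>q' \<le> d\<close>, and when the cap \<open>l + d\<close> is reached, the
      case assumption on \<open>N\<close> applies.\<close>
    have e'3: "N \<le> q' * e' + l + d"
    proof (cases "(N - l) div q' \<le> l + d")
      case True
      then have "e' = (N - l) div q'" by (simp add: e'_def)
      then have "N - l < q' * e' + q'"
        using q'(2) by (metis add.commute dividend_less_times_div)
      moreover have "q' \<le> d" using d q' by simp
      ultimately show ?thesis by linarith
    next
      case False
      then have "e' = l + d" by (simp add: e'_def)
      then show ?thesis using True q' by simp
    qed
    have e'4: "e' \<le> l + d" by (simp add: e'_def)
    obtain T where T: "T \<subseteq> X" "recip T = r" "\<Sum>T = e'"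
      using digit[of e'] e'1 e'4 by auto
    have "N - q' * e' \<in> {l..l+d}" using e'2 e'3 Nl by auto
    then obtain S where S: "S \<subseteq> X" "recip S = r" "\<Sum>S = N - q' * e'"
      using digit by blast
    have fins: "finite S" "finite T" using S T fin finite_subset by auto
    have disj: "S \<inter> (*) q' ` T = {}"
      using S T dis q'_def by auto
    have "recip (S \<union> (*) q' ` T) = r + r / of_nat q'"
      using recip_union_disjoint[OF fins(1) finite_imageI[OF fins(2)] disj] recip_times[OF q'(2)] S T
      by simp
    also have "\<dots> = r * of_nat q / of_nat (q - 1)"
      using q' by (simp add: field_simps)
    finally have 1: "recip (S \<union> (*) q' ` T) = r * of_nat q / of_nat (q - 1)" .
    have "\<Sum>(S \<union> (*) q' ` T) = N"
      using sum.union_disjoint[OF fins(1) finite_imageI[OF fins(2)] disj, of "\<lambda>x. x"]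
        sum_times[OF q'(2)] S T e'2 Nl by simp
    moreover have "0 \<notin> S \<union> (*) q' ` T" using S T X0 q' by auto
    moreover have "smooth K (S \<union> (*) q' ` T)"
      using S T K q' by (intro smooth_union smooth_times smX) auto
    ultimately show ?thesis using 1 fins
      by (intro exI[of _ "S \<union> (*) q' ` T"]) (simp add: is_alpha_partition_recip)
  next
    case False
    \<comment> \<open>The digit sum is the element of \<open>{l..<l + q}\<close> congruent to
      \<open>N\<close> modulo \<open>q\<close>.\<close>
    define e where "e = l + (N - l) mod q"
    have "(N - l) mod q < q" using q by simp
    then have e: "e \<ge> l" "e < l + q" by (auto simp: e_def)
    have "q \<le> d" using d by simp
    have "l + d \<le> q * (l + d)" using q by simp
    then have eN: "e \<le> N" using False e \<open>q \<le> d\<close> by linarith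
    define N' where "N' = (N - l) div q"
    have N': "N = q * N' + e"
    proof -
      have "N \<ge> l" using eN e by simp
      then show ?thesis by (simp add: e_def N'_def)
    qed
    have "q * N' + l + q > q * (l + d)" using False e N' by simp
    \<comment> \<open>The size of \<open>d\<close> is what forces \<open>N' \<ge> q * l\<close> for
      \<open>N\<close> beyond the base range, so that the induction hypothesis covers
      \<open>N'\<close>.\<close>
    moreover have "q * d \<ge> q * (q * l) + l + q"
    proof -
      have "q * ((q + 1) * l + q) \<le> q * d" using d by (intro mult_left_mono) auto
      moreover have "q * ((q + 1) * l + q) = q * (q * l) + q * l + q * q" by (simp add: algebra_simps)
      moreover have "q * l \<ge> l" "q * q \<ge> q" using q by auto
      ultimately show ?thesis by linarith
    qed
    ultimately have "q * N' \<ge> q * (q * l)"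
      unfolding distrib_left by linarith
    then have N'1: "N' \<ge> q * l" using q by (subst (asm) mult_le_cancel1) auto
    \<comment> \<open>The recursion descends because \<open>e \<ge> l > 0\<close>.\<close>
    have "1 * N' \<le> q * N'" using q by (intro mult_right_mono) auto
    then have "N' \<le> q * N'" by simp
    then have "N' < N" using N' e l by linarith
    then obtain T where T: "is_alpha_partition (r * of_nat q / of_nat (q - 1)) N' T" "smooth K T"
      using less.IH[OF _ N'1] by blast
    obtain S where S: "S \<subseteq> X" "recip S = r" "\<Sum>S = e"
      using digit[of e] e \<open>q \<le> d\<close> by auto
    have q0: "q > 0" using q by simp
    have fins: "finite S" "finite T" using S T fin finite_subset by (auto simp: is_alpha_partition_recip)
    have disj: "S \<inter> (*) q ` T = {}" using S(1) ndvd by fastforce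
    have "recip (S \<union> (*) q ` T) = r + (r * of_nat q / of_nat (q - 1)) / of_nat q"
      using recip_union_disjoint[OF fins(1) finite_imageI[OF fins(2)] disj] recip_times[OF q0] S T
      by (simp add: is_alpha_partition_recip)
    also have "\<dots> = r + r / of_nat q'"
      using q0 by (simp add: q'_def)
    also have "\<dots> = r * of_nat q / of_nat (q - 1)"
      using q' by (simp add: field_simps)
    finally have 1: "recip (S \<union> (*) q ` T) = r * of_nat q / of_nat (q - 1)" .
    have "\<Sum>(S \<union> (*) q ` T) = N"
      using sum.union_disjoint[OF fins(1) finite_imageI[OF fins(2)] disj, of "\<lambda>x. x"]
        sum_times[OF q0] S T N' by (simp add: is_alpha_partition_recip)
    moreover have "0 \<notin> S \<union> (*) q ` T" using S T X0 q0 by (auto simp: is_alpha_partition_recip)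
    moreover have "smooth K (S \<union> (*) q ` T)"
      by (intro smooth_union smooth_times smX S(1) T(2) q0 K(1))
    ultimately show ?thesis using 1 fins
      by (intro exI[of _ "S \<union> (*) q ` T"]) (simp add: is_alpha_partition_recip)
  qed
qed

text \<open>Found by computer search. In addition to the conditions in \<open>chain\<close>, no entry is a multiple
  of 5 or four times another entry, so that the recursion above applies with \<open>q = 5\<close>.\<close>
definition gadgets :: "(nat list \<times> nat list) list" where
  "gadgets =
    [([1386], [2772, 4158, 8316]), ([624], [1248, 1872, 3744]), ([323], [646, 969, 1938]),
     ([171], [342, 513, 1026]), ([121], [242, 363, 726]), ([91], [182, 273, 546]),
     ([17], [34, 51, 153, 306]), ([23], [46, 69, 138]), ([19], [38, 57, 114]),
     ([49, 294], [81, 162, 189]), ([16], [24, 48]), ([119, 238], [112, 272]),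
     ([52, 63, 117], [44, 77, 126]), ([102, 187], [99, 198]), ([27, 54, 72], [33, 36, 88]),
     ([39, 78, 143], [42, 66, 154]), ([2, 21], [3, 7, 14])]"

lemma smooth_partitions:
  "\<exists>\<beta> N\<^sub>0 K. \<beta> \<ge> 0 \<and> (\<forall>N\<ge>N\<^sub>0. \<exists>S. is_alpha_partition \<beta> N S \<and> smooth K S)"
proof -
  have ch: "chain gadgets" "distinct (support gadgets)"
    by (simp_all add: gadgets_def)
  have num: "low gadgets > 0" "(5 + 1) * low gadgets + 5 \<le> width gadgets"
    by (simp_all add: gadgets_def)
  \<comment> \<open>10000 is a round bound for the entries, the largest being 8316; it serves as the
    smoothness bound.\<close>
  have X: "list_all (\<lambda>x. 0 < x \<and> x \<le> 10000 \<and> \<not> 5 dvd x \<and> 4 * x \<notin> set (support gadgets))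
             (support gadgets)"
    by (simp add: gadgets_def)
  obtain r where r: "r \<ge> 0" "spans (set (support gadgets)) r (low gadgets) (width gadgets)"
    using spans_chain[OF ch] by blast
  have "\<exists>S. is_alpha_partition (r * of_nat 5 / of_nat (5 - 1)) N S \<and> smooth 10000 S"
    if "N \<ge> 5 * low gadgets" for N
    by (rule smooth_partitions_of_spans[OF r(2)])
      (use X num that in \<open>auto simp: list_all_iff\<close>)
  then show ?thesis using r(1)
    by (intro exI[of _ "r * of_nat 5 / of_nat (5 - 1)"] exI[of _ "5 * low gadgets"] exI[of _ 10000]) auto
qed

section \<open>Chebyshev's bound\<close>

text \<open>The numbers \<open>1 / (k * (n choose k))\<close> form Leibniz's harmonic triangle, in which each entry
  is the sum of the two below it; the outermost entries are \<open>1 / n\<close>.\<close>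
lemma binomial_times_dvd:
  fixes L :: nat
  assumes "\<And>i. 1 \<le> i \<Longrightarrow> i \<le> n \<Longrightarrow> i dvd L" "1 \<le> k" "k \<le> n"
  shows "k * (n choose k) dvd L"
  using assms(2,3,1)
proof (induction k arbitrary: n rule: dec_induct)
  case base
  then show ?case by simp
next
  case (step k)
  obtain m where n: "n = Suc m" using step by (cases n) auto
  let ?a = "k * (n choose k)" and ?b = "Suc k * (n choose Suc k)" and ?c = "k * (m choose k)"
  have dv: "?a dvd L" "?c dvd L" using step n by auto
  have pos: "n choose k > 0" "n choose Suc k > 0" "m choose k > 0" "k > 0"
    using step n by auto
  have e1: "Suc k * (n choose Suc k) = n * (m choose k)"
    using Suc_times_binomial[of k m] n by simp
  have e2: "(n - k) * (n choose k) = n * (m choose k)"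
    using binomial_absorb_comp[of n k] n by simp
  have e2': "(real n - real k) * real (n choose k) = real n * real (m choose k)"
    using arg_cong[OF e2, of real] step by (simp add: of_nat_diff)
  have r: "real n - real k > 0" "real n > 0" using step by auto
  have "1 / real ?b = 1 / (real n * real (m choose k))" by (subst e1) simp
  also have "\<dots> = 1 / real ?c - 1 / real ?a"
  proof -
    have "real (n choose k) = real n * real (m choose k) / (real n - real k)"
      using e2' r by (simp add: field_simps)
    then have "1 / real ?a = (real n - real k) / (real k * (real n * real (m choose k)))"
      by simp
    also have "\<dots> = 1 / real ?c - 1 / (real n * real (m choose k))"
      using pos r by (simp add: field_simps)
    finally show ?thesis by simp
  qed
  \<comment> \<open>After multiplication by \<open>L\<close> the right-hand side is a difference of
    integers, by \<open>dv\<close>; hence \<open>?b\<close> divides \<open>L\<close>.\<close>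
  finally have "real L / real ?b = real L / real ?c - real L / real ?a"
    by (metis (no_types) mult.right_neutral right_diff_distrib times_divide_eq_right)
  also have "\<dots> = of_int (int (L div ?c) - int (L div ?a))"
    using dv by (simp add: real_of_nat_div)
  finally have "real L = of_int (int (L div ?c) - int (L div ?a)) * real ?b"
    using pos by (subst (asm) nonzero_divide_eq_eq) (simp_all del: of_int_diff mult_Suc)
  then have "real_of_int (int L) = of_int ((int (L div ?c) - int (L div ?a)) * int ?b)"
    by (simp only: of_int_mult of_int_of_nat_eq)
  then have "int L = (int (L div ?c) - int (L div ?a)) * int ?b"
    by (simp only: of_int_eq_iff)
  then have "int ?b dvd int L" by simp
  then show ?case by (simp only: of_nat_dvd_iff)
qed

text \<open>The witness is the least common multiple of 1, ..., n, written as the product over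
  primes \<open>p \<le> n\<close> of the largest power of \<open>p\<close> not exceeding
  \<open>n\<close>. Each factor is at most \<open>n\<close>.\<close>

lemma common_multiple_le_power_card_primes:
  fixes n :: nat
  assumes "n \<ge> 1"
  shows "\<exists>L>0. (\<forall>i. 1 \<le> i \<and> i \<le> n \<longrightarrow> i dvd L) \<and> L \<le> n ^ card {p. prime p \<and> p \<le> n}"
proof -
  define P where "P = {p::nat. prime p \<and> p \<le> n}"
  \<comment> \<open>The condition \<open>k \<le> n\<close> keeps the set finite for every
    \<open>p\<close>, including 0 and 1.\<close>
  define e where "e p = Max {k. k \<le> n \<and> p ^ k \<le> n}" for p
  have fin: "finite {k. k \<le> n \<and> p ^ k \<le> n}" for p by simp
  have finP: "finite P" by (auto simp: P_def)
  have e: "p ^ e p \<le> n" for p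
  proof -
    have "e p \<in> {k. k \<le> n \<and> p ^ k \<le> n}"
      unfolding e_def using assms by (intro Max_in fin) (auto intro!: exI[of _ 0])
    then show ?thesis by simp
  qed
  have e_ge: "k \<le> e p" if "prime p" "p ^ k \<le> n" for k p
  proof -
    have "k < 2 ^ k" by simp
    also have "\<dots> \<le> p ^ k" using prime_ge_2_nat[OF that(1)] by (intro power_mono) auto
    finally show ?thesis unfolding e_def using that by (intro Max_ge fin) auto
  qed
  have "i dvd (\<Prod>p\<in>P. p ^ e p)" if i: "1 \<le> i" "i \<le> n" for i
  proof -
    have "i = (\<Prod>p\<in>prime_factors i. p ^ multiplicity p i)"
      using i by (intro prime_factorization_nat) auto
    also have "\<dots> dvd (\<Prod>p\<in>prime_factors i. p ^ e p)"
    proof (intro prod_dvd_prod le_imp_power_dvd e_ge)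
      fix p assume "p \<in> prime_factors i"
      then show "prime p" by auto
      have "p ^ multiplicity p i \<le> i"
        using i by (intro dvd_imp_le multiplicity_dvd) auto
      then show "p ^ multiplicity p i \<le> n" using i by simp
    qed
    also have "\<dots> dvd (\<Prod>p\<in>P. p ^ e p)"
      using i finP by (intro prod_dvd_prod_subset) (auto simp: P_def prime_factors_dvd dest!: dvd_imp_le)
    finally show ?thesis .
  qed
  moreover have "(\<Prod>p\<in>P. p ^ e p) \<le> n ^ card P"
    using prod_mono[of P "\<lambda>p. p ^ e p" "\<lambda>_. n"] e by simp
  moreover have "(\<Prod>p\<in>P. p ^ e p) > 0"
    by (intro prod_pos) (auto simp: P_def prime_gt_0_nat)
  ultimately show ?thesis unfolding P_def by blast
qed

text \<open>With \<open>m = n div 2\<close>, the number \<open>m * (2 * m choose m)\<close> divides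
  the common multiple and is at least 4^m / 2; logarithms are then compared. The 2 subtracted from
  \<open>n\<close> pays for the halving and for the parity of \<open>n\<close>.\<close>

lemma card_primes_lower_bound:
  fixes n :: nat
  assumes "n \<ge> 2"
  shows "(real n - 2) * ln 2 \<le> real (card {p. prime p \<and> p \<le> n}) * ln (real n)"
proof -
  define m where "m = n div 2"
  have m: "m \<ge> 1" "2 * m \<le> n" "n \<le> 2 * m + 1" using assms by (auto simp: m_def)
  obtain L where L: "L > 0" "\<And>i. 1 \<le> i \<Longrightarrow> i \<le> n \<Longrightarrow> i dvd L"
      "L \<le> n ^ card {p. prime p \<and> p \<le> n}"
    using common_multiple_le_power_card_primes[of n] assms by auto
  have "m * (2 * m choose m) dvd L"
    using m L(2) by (intro binomial_times_dvd) auto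
  then have "m * (2 * m choose m) \<le> L" using L(1) dvd_imp_le by blast
  then have le: "real m * real (2 * m choose m) \<le> real n ^ card {p. prime p \<and> p \<le> n}"
    using L(3) by (metis (no_types) le_trans of_nat_le_iff of_nat_mult of_nat_power)
  have "4 ^ m / 2 = real m * (4 ^ m / (2 * real m))" using m by simp
  also have "\<dots> \<le> real m * real (2 * m choose m)"
    using m by (intro mult_left_mono central_binomial_lower_bound) auto
  also note le
  finally have "ln (4 ^ m / 2 :: real) \<le> ln (real n ^ card {p. prime p \<and> p \<le> n})"
    by (intro ln_mono) auto
  also have "\<dots> = real (card {p. prime p \<and> p \<le> n}) * ln (real n)"
    using assms by (simp add: ln_realpow)
  finally have "ln (4 ^ m / 2 :: real) \<le> real (card {p. prime p \<and> p \<le> n}) * ln (real n)" .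
  moreover have "ln (4 ^ m / 2 :: real) = (2 * real m - 1) * ln 2"
    using ln_realpow[of 2 2] by (simp add: ln_div ln_realpow algebra_simps)
  moreover have "(real n - 2) * ln 2 \<le> (2 * real m - 1) * ln (2::real)"
    using m by (intro mult_right_mono) auto
  ultimately show ?thesis by linarith
qed

section \<open>Growth of the primes above K\<close>

definition large_prime :: "nat \<Rightarrow> nat \<Rightarrow> nat" where
  "large_prime K = enumerate {p. prime p \<and> p > K}"

lemma infinite_large_primes: "infinite {p::nat. prime p \<and> p > K}"
proof
  assume "finite {p::nat. prime p \<and> p > K}"
  then have "finite ({p::nat. prime p \<and> p > K} \<union> {..K})" by simp
  moreover have "{p::nat. prime p} \<subseteq> {p. prime p \<and> p > K} \<union> {..K}" by auto
  ultimately show False using primes_infinite finite_subset by blast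
qed

lemma large_prime: "prime (large_prime K k)" "large_prime K k > K"
  using enumerate_in_set[OF infinite_large_primes] by (auto simp: large_prime_def)

lemma strict_mono_large_prime: "strict_mono (large_prime K)"
  unfolding large_prime_def by (intro strict_monoI enumerate_mono infinite_large_primes)

text \<open>All primes up to x = \<open>large_prime K k\<close> lie in \<open>{1..K}\<close> or
  among the \<open>k + 1\<close> enumerated ones. This count goes into
  \<open>card_primes_lower_bound\<close>, and the error 2 ln 2 is absorbed as 2 ln x.\<close>

lemma large_prime_le:
  "real (large_prime K k) * ln 2 \<le> (real k + real K + 3) * ln (real (large_prime K k))"
proof -
  define x where "x = large_prime K k"
  have x: "x \<ge> 2" using large_prime(1)[of K k] prime_ge_2_nat by (auto simp: x_def)
  have "{p. prime p \<and> p \<le> x} \<subseteq> {1..K} \<union> large_prime K ` {..k}"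
  proof
    fix p assume p: "p \<in> {p. prime p \<and> p \<le> x}"
    show "p \<in> {1..K} \<union> large_prime K ` {..k}"
    proof (cases "p \<le> K")
      case True
      then show ?thesis using p prime_gt_0_nat[of p] by auto
    next
      case False
      then obtain j where j: "large_prime K j = p"
        using enumerate_Ex[of "{p. prime p \<and> p > K}" p] infinite_large_primes p
        unfolding large_prime_def by auto
      then have "j \<le> k" using p strict_mono_large_prime[of K]
        by (auto simp: x_def strict_mono_less_eq)
      then show ?thesis using j by auto
    qed
  qed
  then have "card {p. prime p \<and> p \<le> x} \<le> card ({1..K} \<union> large_prime K ` {..k})"
    by (intro card_mono) auto
  also have "\<dots> \<le> K + (k + 1)"
    using card_image_le[of "{..k}" "large_prime K"] by (intro order.trans[OF card_Un_le]) simp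
  finally have c: "real (card {p. prime p \<and> p \<le> x}) \<le> real K + real k + 1" by linarith
  have "(real x - 2) * ln 2 \<le> real (card {p. prime p \<and> p \<le> x}) * ln (real x)"
    by (rule card_primes_lower_bound[OF x])
  also have "\<dots> \<le> (real K + real k + 1) * ln (real x)"
    using c x by (intro mult_right_mono) auto
  finally have "real x * ln 2 \<le> (real K + real k + 1) * ln (real x) + 2 * ln 2"
    by (simp add: algebra_simps)
  also have "\<dots> \<le> (real K + real k + 1) * ln (real x) + 2 * ln (real x)"
    using x by simp
  finally show ?thesis by (simp add: algebra_simps flip: x_def)
qed

text \<open>A crude bound, used only to replace the logarithm of the prime by a multiple of ln k.
  For large x the inequality in \<open>x0\<close> contradicts \<open>large_prime_le\<close> unless x
  powr (1 / (1 + \<epsilon>)) is at most \<open>k\<close>.\<close>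

lemma large_prime_le_powr:
  assumes "\<epsilon> > 0"
  shows "\<forall>\<^sub>F k in sequentially. real (large_prime K k) \<le> real k powr (1 + \<epsilon>)"
proof -
  have "\<forall>\<^sub>F x::real in at_top. (x powr (1 / (1 + \<epsilon>)) + real K + 4) * ln x < x * ln 2"
    using assms by real_asymp
  then obtain x0 where x0: "\<And>x. x \<ge> x0 \<Longrightarrow> (x powr (1 / (1 + \<epsilon>)) + real K + 4) * ln x < x * ln 2"
    unfolding eventually_at_top_linorder by blast
  have "\<forall>\<^sub>F k in sequentially. real (large_prime K k) \<ge> x0"
    using filterlim_compose[OF filterlim_real_sequentially filterlim_subseq[OF strict_mono_large_prime[of K]]]
    unfolding filterlim_at_top by blast
  then show ?thesis
  proof eventually_elim
    case (elim k)
    let ?x = "real (large_prime K k)"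
    have x: "?x \<ge> 2" using large_prime(1)[of K k] prime_ge_2_nat by (metis of_nat_le_iff of_nat_numeral)
    have "(?x powr (1 / (1 + \<epsilon>)) + real K + 4) * ln ?x < (real k + real K + 3) * ln ?x"
      using x0[OF elim] large_prime_le[of K k] by linarith
    then have "?x powr (1 / (1 + \<epsilon>)) \<le> real k"
      using x by (simp add: mult_less_cancel_right)
    then have "(?x powr (1 / (1 + \<epsilon>))) powr (1 + \<epsilon>) \<le> real k powr (1 + \<epsilon>)"
      using assms by (intro powr_mono2) auto
    then show ?case using assms x by (simp add: powr_powr)
  qed
qed

section \<open>Counting sets of primes and their doubles\<close>

text \<open>Multiplying by the product \<open>R\<close> of the other primes turns all terms but that
  of \<open>p\<close> into integers. Hence \<open>p\<close> divides \<open>d p * R\<close>, and it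
  does not divide \<open>R\<close>.\<close>

lemma dvd_of_sum_divide_primes_eq_0:
  fixes d :: "nat \<Rightarrow> int"
  assumes P: "finite P" "\<And>p. p \<in> P \<Longrightarrow> prime p"
    and sum: "(\<Sum>p\<in>P. of_int (d p) / of_nat p :: rat) = 0" and p: "p \<in> P"
  shows "int p dvd d p"
proof -
  define R where "R = \<Prod>(P - {p})"
  have p0: "prime p" "p > 0" using P p prime_gt_0_nat by auto
  have "of_int (d q) / of_nat q * of_nat R = (of_int (d q * int (R div q)) :: rat)"
    if "q \<in> P - {p}" for q
  proof -
    have "q dvd R" unfolding R_def using P that by (intro dvd_prodI) auto
    moreover have "q > 0" using P that prime_gt_0_nat by auto
    ultimately have "(of_nat R :: rat) = of_nat q * of_nat (R div q)" "(of_nat q :: rat) \<noteq> 0"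
      by (metis dvd_mult_div_cancel of_nat_mult, simp)
    then show ?thesis by simp
  qed
  then have Z: "(\<Sum>q\<in>P - {p}. of_int (d q) / of_nat q) * of_nat R
      = (of_int (\<Sum>q\<in>P - {p}. d q * int (R div q)) :: rat)"
    unfolding sum_distrib_right of_int_sum by (intro sum.cong) auto
  define Z where "Z = (\<Sum>q\<in>P - {p}. d q * int (R div q))"
  have "of_int (d p) / of_nat p + (\<Sum>q\<in>P - {p}. of_int (d q) / of_nat q) = (0::rat)"
    using sum P p by (simp add: sum.remove)
  then have "of_int (d p) / of_nat p * of_nat R + of_int Z = (0::rat)"
    using Z by (metis Z_def distrib_right mult_zero_left)
  then have "of_int (d p * int R) = (of_int (- Z * int p) :: rat)"
    using p0 by (simp add: field_simps eq_neg_iff_add_eq_0)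
  then have "d p * int R = - Z * int p" by (simp only: of_int_eq_iff)
  then have "int p dvd d p * int R" by simp
  then have "int p dvd d p \<or> int p dvd int R"
    using p0 by (simp add: prime_dvd_mult_iff)
  moreover have "\<not> p dvd R"
  proof
    assume "p dvd R"
    then obtain q where "q \<in> P - {p}" "p dvd q"
      unfolding R_def using P p0 by (auto simp: prime_dvd_prod_iff)
    then show False using P p0 primes_dvd_imp_eq by blast
  qed
  ultimately show ?thesis by simp
qed

text \<open>Terms with the same \<open>p\<close> are combined: the numerator takes the values 0, 1,
  2, 3, one for each subset of {p, 2p}.\<close>

lemma recip_primes_and_doubles:
  assumes P: "finite P" "\<And>p. p \<in> P \<Longrightarrow> prime p \<and> p > 2" and T: "T \<subseteq> P \<union> (*) 2 ` P"
  shows "recip T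
    = (\<Sum>p\<in>P. of_int (2 * of_bool (p \<in> T) + of_bool (2 * p \<in> T)) / of_nat p) / 2"
proof -
  have disj: "P \<inter> (*) 2 ` P = {}"
  proof -
    have "odd p" if "p \<in> P" for p using P that prime_odd_nat by auto
    then show ?thesis by fastforce
  qed
  have "T = (P \<inter> T) \<union> ((*) 2 ` P \<inter> T)" using T by auto
  then have "recip T = recip (P \<inter> T) + recip ((*) 2 ` P \<inter> T)"
    using recip_union_disjoint[of "P \<inter> T" "(*) 2 ` P \<inter> T"] P disj by auto
  also have "recip (P \<inter> T) = (\<Sum>p\<in>P. of_bool (p \<in> T) / of_nat p)"
    unfolding recip_def using P by (subst sum.inter_restrict) (auto intro!: sum.cong)
  also have "recip ((*) 2 ` P \<inter> T) = (\<Sum>p\<in>(*) 2 ` P. of_bool (p \<in> T) / of_nat p)"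
    unfolding recip_def using P by (subst sum.inter_restrict) (auto intro!: sum.cong)
  also have "\<dots> = (\<Sum>p\<in>P. of_bool (2 * p \<in> T) / of_nat p) / 2"
    by (subst sum.reindex) (auto simp: inj_on_def sum_divide_distrib intro!: sum.cong)
  also have "(\<Sum>p\<in>P. of_bool (p \<in> T) / of_nat p) + (\<Sum>p\<in>P. of_bool (2 * p \<in> T) / of_nat p) / 2
      = (\<Sum>p\<in>P. (2 * of_bool (p \<in> T) + of_bool (2 * p \<in> T)) / of_nat p :: rat) / 2"
    by (simp add: sum_divide_distrib sum.distrib add_divide_distrib)
  finally show ?thesis by simp
qed

text \<open>For equal reciprocal sums, \<open>p\<close> divides the difference of the two
  numerators, which is at most 3 in absolute value and so vanishes for \<open>p > 3\<close>. The
  numerator then determines which of p and 2p belong to the set.\<close>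

lemma inj_on_recip:
  assumes P: "finite P" "\<And>p. p \<in> P \<Longrightarrow> prime p \<and> p > 3"
  shows "inj_on recip (Pow (P \<union> (*) 2 ` P))"
proof (rule inj_onI)
  fix S T assume ST: "S \<in> Pow (P \<union> (*) 2 ` P)" "T \<in> Pow (P \<union> (*) 2 ` P)" "recip S = recip T"
  define s where "s X p = (2 * of_bool (p \<in> X) + of_bool (2 * p \<in> X) :: int)" for X :: "nat set" and p
  have P2: "\<And>p. p \<in> P \<Longrightarrow> prime p \<and> p > 2" using P(2) by (metis Suc_lessD eval_nat_numeral(3))
  have "(\<Sum>p\<in>P. of_int (s S p - s T p) / of_nat p) = (0::rat)"
    using ST recip_primes_and_doubles[OF P(1) P2, of S] recip_primes_and_doubles[OF P(1) P2, of T]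
    by (simp add: s_def diff_divide_distrib sum_subtractf)
  then have dvd: "int p dvd s S p - s T p" if "p \<in> P" for p
    using dvd_of_sum_divide_primes_eq_0[of P "\<lambda>p. s S p - s T p" p] P that by auto
  have eq: "s S p = s T p" if p: "p \<in> P" for p
  proof (rule ccontr)
    assume "s S p \<noteq> s T p"
    then have "int p \<le> \<bar>s S p - s T p\<bar>" using dvd[OF p] dvd_imp_le_int[of _ "int p"] by simp
    moreover have "\<bar>s S p - s T p\<bar> \<le> 3" by (auto simp: s_def)
    ultimately show False using P(2)[OF p] by linarith
  qed
  have "p \<in> S \<longleftrightarrow> p \<in> T" "2 * p \<in> S \<longleftrightarrow> 2 * p \<in> T" if "p \<in> P" for p
    using eq[OF that] by (auto simp: s_def of_bool_def split: if_splits)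
  then show "S = T" using ST by blast
qed

text \<open>Of a subset and its complement, at least one has at most half of the total sum.\<close>

lemma card_subsets_sum_le_half:
  fixes X :: "nat set"
  assumes "finite X"
  shows "2 ^ card X \<le> 2 * card {T. T \<subseteq> X \<and> 2 * \<Sum>T \<le> \<Sum>X}"
proof -
  let ?H = "{T. T \<subseteq> X \<and> 2 * \<Sum>T \<le> \<Sum>X}"
  have fin: "finite ?H" using assms by (intro finite_subset[of ?H "Pow X"]) auto
  have "Pow X \<subseteq> ?H \<union> (\<lambda>T. X - T) ` ?H"
  proof
    fix T assume T: "T \<in> Pow X"
    have "\<Sum>X = \<Sum>(X - T) + \<Sum>T"
      using sum.subset_diff[of T X "\<lambda>x. x"] T assms by auto
    then have "T \<in> ?H \<or> X - T \<in> ?H" using T by auto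
    moreover have "T = X - (X - T)" using T by auto
    ultimately show "T \<in> ?H \<union> (\<lambda>T. X - T) ` ?H" by blast
  qed
  then have "card (Pow X) \<le> card (?H \<union> (\<lambda>T. X - T) ` ?H)"
    using fin by (intro card_mono) auto
  also have "\<dots> \<le> card ?H + card ?H"
    using card_image_le[OF fin] by (intro order.trans[OF card_Un_le]) auto
  finally show ?thesis using assms by (simp add: card_Pow)
qed

section \<open>Lower bound for the size of A(n)\<close>

lemma mem_A_I:
  assumes "\<alpha> > 0" "n > 0" "\<And>N. N \<ge> n \<Longrightarrow> has_alpha_partition \<alpha> N"
  shows "\<alpha> \<in> A n"
proof -
  have "n_alpha \<alpha> \<le> enat n" unfolding n_alpha_def using assms by (intro Inf_lower) auto
  then show ?thesis using assms by (simp add: A_def)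
qed

text \<open>All p and 2p together have sum three times that of the primes. The premise, doubled to
  avoid fractions, says that half of it plus \<open>N\<^sub>0\<close> is at most \<open>n\<close>;
  this leaves at least \<open>N\<^sub>0\<close> for the smooth part.\<close>

lemma card_A_ge:
  "\<exists>K N\<^sub>0. \<forall>M n. n > 0 \<longrightarrow> 3 * (\<Sum>k<M. large_prime K k) + 2 * N\<^sub>0 \<le> 2 * n \<longrightarrow> 4 ^ M \<le> 2 * card (A n)"
proof -
  obtain \<beta> N\<^sub>0 K\<^sub>0 where sm0: "\<And>N. N \<ge> N\<^sub>0 \<Longrightarrow> \<exists>S. is_alpha_partition \<beta> N S \<and> smooth K\<^sub>0 S" and "\<beta> \<ge> 0"
    using smooth_partitions by blast
  \<comment> \<open>Taking \<open>K \<ge> 3\<close> makes the primes above \<open>K\<close> large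
    enough for \<open>inj_on_recip\<close>.\<close>
  define K where "K = max K\<^sub>0 3"
  have sm: "\<exists>S. is_alpha_partition \<beta> N S \<and> smooth K S" if "N \<ge> N\<^sub>0" for N
    using sm0[OF that] unfolding smooth_def K_def by (meson le_max_iff_disj)
  have "\<beta> > 0"
  proof -
    \<comment> \<open>\<open>Suc N\<^sub>0\<close> is positive, so the set that sums to it is
      nonempty.\<close>
    obtain S where S: "is_alpha_partition \<beta> (Suc N\<^sub>0) S" using sm[of "Suc N\<^sub>0"] by auto
    then have "S \<noteq> {}" by (auto simp: is_alpha_partition_def)
    then have "(\<Sum>a\<in>S. 1 / of_nat a :: rat) > 0"
      using S by (intro sum_pos) (auto simp: is_alpha_partition_def)
    then show ?thesis using S by (simp add: is_alpha_partition_def)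
  qed
  have "4 ^ M \<le> 2 * card (A n)"
    if n: "n > 0" and M: "3 * (\<Sum>k<M. large_prime K k) + 2 * N\<^sub>0 \<le> 2 * n" for M n
  proof -
    define P where "P = large_prime K ` {..<M}"
    define X where "X = P \<union> (*) 2 ` P"
    have inj: "inj_on (large_prime K) {..<M}"
      using strict_mono_large_prime strict_mono_imp_inj_on subset_UNIV inj_on_subset by blast
    have P: "finite P" "card P = M" "\<Sum>P = (\<Sum>k<M. large_prime K k)"
      using inj by (auto simp: P_def card_image sum.reindex)
    have Pp: "prime p \<and> p > K" if "p \<in> P" for p
      using that large_prime by (auto simp: P_def)
    have disj: "P \<inter> (*) 2 ` P = {}"
    proof -
      have "odd p" if "p \<in> P" for p using Pp[OF that] prime_odd_nat by (auto simp: K_def)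
      then show ?thesis by fastforce
    qed
    have X: "finite X" "card X = 2 * M" "\<Sum>X = 3 * \<Sum>P"
    proof -
      show "finite X" using P by (simp add: X_def)
      have "card ((*) 2 ` P) = M" using P by (simp add: card_image inj_on_def)
      then show "card X = 2 * M" unfolding X_def using P disj by (subst card_Un_disjoint) auto
      have "\<Sum>X = \<Sum>P + \<Sum>((*) 2 ` P)" unfolding X_def using P disj by (subst sum.union_disjoint) auto
      then show "\<Sum>X = 3 * \<Sum>P" using sum_times[of 2 P] by simp
    qed
    define H where "H = {T. T \<subseteq> X \<and> 2 * \<Sum>T \<le> \<Sum>X}"
    have "(\<lambda>T. \<beta> + recip T) ` H \<subseteq> A n"
    proof safe
      fix T assume T: "T \<in> H"
      have finT: "finite T" using T X finite_subset by (auto simp: H_def)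
      have T0: "0 \<notin> T" using T Pp[of 0] by (auto simp: H_def X_def)
      show "\<beta> + recip T \<in> A n"
      proof (rule mem_A_I[OF _ n])
        have "recip T \<ge> 0" by (simp add: recip_def sum_nonneg)
        then show "\<beta> + recip T > 0" using \<open>\<beta> > 0\<close> by simp
        fix N assume "N \<ge> n"
        then have N: "\<Sum>T \<le> N" "N - \<Sum>T \<ge> N\<^sub>0" using T M X P by (auto simp: H_def)
        then obtain S where S: "is_alpha_partition \<beta> (N - \<Sum>T) S" "smooth K S"
          using sm by blast
        have disj: "S \<inter> T = {}"
        proof (rule ccontr)
          assume "S \<inter> T \<noteq> {}"
          then obtain a where a: "a \<in> S" "a \<in> X" using T by (auto simp: H_def)
          then obtain p where p: "p \<in> P" "p dvd a" by (auto simp: X_def)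
          then show False using S(2) a(1) Pp[OF p(1)] by (meson smooth_def not_le)
        qed
        have finS: "finite S" using S by (simp add: is_alpha_partition_recip)
        have "is_alpha_partition (\<beta> + recip T) N (S \<union> T)"
          using S(1) T0 finT N recip_union_disjoint[OF finS finT disj]
            sum.union_disjoint[OF finS finT disj, of "\<lambda>x. x"]
          by (simp add: is_alpha_partition_recip)
        then show "has_alpha_partition (\<beta> + recip T) N"
          unfolding has_alpha_partition_def by blast
      qed
    qed
    then have "card ((\<lambda>T. \<beta> + recip T) ` H) \<le> card (A n)"
      by (intro card_mono finite_subset[OF A_subset_B finite_B])
    moreover have "inj_on (\<lambda>T. \<beta> + recip T) H"
    proof -
      have "prime p \<and> p > 3" if "p \<in> P" for p using Pp[OF that] by (simp add: K_def)
      then have "inj_on recip (Pow X)" unfolding X_def by (rule inj_on_recip[OF P(1)])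
      then show ?thesis by (auto simp: inj_on_def H_def)
    qed
    ultimately have "card H \<le> card (A n)" by (simp add: card_image)
    then have "2 ^ (2 * M) \<le> 2 * card (A n)"
      using card_subsets_sum_le_half[OF X(1)] X(2) by (simp add: H_def)
    then show ?thesis by (simp add: power_mult)
  qed
  then show ?thesis by blast
qed

section \<open>Numerical constants and asymptotics\<close>

lemma ln_2_ge: "ln (2::real) \<ge> 69 / 100"
  using ln_approx_bounds[of 2 2] by (simp add: eval_nat_numeral)

text \<open>\<open>large_prime_le\<close> is summed over \<open>k < M\<close>, with every logarithm
  bounded by that of the prime of index \<open>M\<close>, at most 1.01 ln M. The factor 101 / 69 is
  1.01 divided by the lower bound 0.69 for ln 2.\<close>

lemma sum_large_prime_le:
  "\<forall>\<^sub>F M in sequentially. real (\<Sum>k<M. large_prime K k)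
     \<le> (real M ^ 2 / 2 + (real K + 3) * real M) * (101 / 69 * ln (real M))"
proof -
  have "\<forall>\<^sub>F M in sequentially. real (large_prime K M) \<le> real M powr (1 + 1 / 100)"
    by (intro large_prime_le_powr) simp
  then show ?thesis using eventually_gt_at_top[of 0]
  proof eventually_elim
    case (elim M)
    have pos: "real (large_prime K M) > 0" using large_prime(1)[of K M] prime_gt_0_nat by simp
    have "ln (real (large_prime K M)) \<le> ln (real M powr (1 + 1 / 100))"
      using elim pos by (intro ln_mono) auto
    then have lnM: "ln (real (large_prime K M)) \<le> 101 / 100 * ln (real M)"
      using elim by (simp add: ln_powr)
    have "real (large_prime K k) \<le> (real k + real K + 3) * (101 / 69 * ln (real M))" if k: "k < M" for k
    proof -
      have pos: "real (large_prime K k) > 0" using large_prime(1)[of K k] prime_gt_0_nat by simp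
      have "large_prime K k \<le> large_prime K M"
        using k strict_mono_large_prime by (simp add: strict_mono_less_eq)
      then have "ln (real (large_prime K k)) \<le> ln (real (large_prime K M))"
        using pos by (intro ln_mono) auto
      also note lnM
      finally have "real (large_prime K k) * ln 2 \<le> (real k + real K + 3) * (101 / 100 * ln (real M))"
        using large_prime_le[of K k]
        by (elim order.trans) (intro mult_left_mono, auto)
      moreover have "real (large_prime K k) * (69 / 100) \<le> real (large_prime K k) * ln 2"
        using ln_2_ge by (intro mult_left_mono) auto
      ultimately show ?thesis by simp
    qed
    then have "(\<Sum>k<M. real (large_prime K k)) \<le> (\<Sum>k<M. (real k + real K + 3) * (101 / 69 * ln (real M)))"
      by (intro sum_mono) auto
    also have "\<dots> = (\<Sum>k<M. real k + real K + 3) * (101 / 69 * ln (real M))"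
      by (rule sum_distrib_right[symmetric])
    also have "(\<Sum>k<M. real k + real K + 3) \<le> real M ^ 2 / 2 + (real K + 3) * real M"
    proof -
      have "(\<Sum>k<M. real k) \<le> real M ^ 2 / 2"
        by (induction M) (auto simp: power2_eq_square field_simps)
      then show ?thesis by (simp add: sum.distrib algebra_simps)
    qed
    finally show ?case using elim by (simp add: mult_right_mono)
  qed
qed

lemma card_A_gt:
  "\<forall>\<^sub>F n in sequentially. exp (182 / 100 * sqrt (real n / ln (real n))) < real (card (A n))"
proof -
  obtain K N\<^sub>0 where KN: "\<And>M n. n > 0 \<Longrightarrow> 3 * (\<Sum>k<M. large_prime K k) + 2 * N\<^sub>0 \<le> 2 * n
      \<Longrightarrow> 4 ^ M \<le> 2 * card (A n)"
    using card_A_ge by blast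
  \<comment> \<open>The factor 4/3 meets two demands: the limit 101 (4/3)^2 / 92, about 1.95, stays
    below 2, and (4/3) 1.38 = 1.84 exceeds 1.82.\<close>
  define z where "z n = 4 / 3 * sqrt (real n / ln (real n))" for n
  define M where "M n = nat \<lfloor>z n\<rfloor>" for n
  have "filterlim z at_top sequentially"
    unfolding z_def by real_asymp
  then have limM: "filterlim M at_top sequentially"
    unfolding M_def
    by (intro filterlim_compose[OF filterlim_nat_sequentially] filterlim_compose[OF filterlim_floor_sequentially])
  have 1: "\<forall>\<^sub>F n in sequentially. real (\<Sum>k<M n. large_prime K k)
     \<le> (real (M n) ^ 2 / 2 + (real K + 3) * real (M n)) * (101 / 69 * ln (real (M n)))"
    using eventually_compose_filterlim[OF sum_large_prime_le limM] .
  have "(\<lambda>n. (3 * ((z n ^ 2 / 2 + (real K + 3) * z n) * (101 / 69 * ln (z n))) + 2 * real N\<^sub>0) / real n)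
      \<longlonglongrightarrow> 101 * (4 / 3)\<^sup>2 / 92"
    unfolding z_def by real_asymp
  then have 2: "\<forall>\<^sub>F n in sequentially.
      (3 * ((z n ^ 2 / 2 + (real K + 3) * z n) * (101 / 69 * ln (z n))) + 2 * real N\<^sub>0) / real n < 2"
    by (rule order_tendstoD(2)) (simp add: power2_eq_square)
  \<comment> \<open>The 1 added on the left absorbs the factor 2 in \<open>KN\<close>, since 2 < e,
    and the 1 subtracted from \<open>z n\<close> accounts for the floor. The factor 138 / 100 bounds
    ln 4 from below.\<close>
  have 3: "\<forall>\<^sub>F n in sequentially. 182 / 100 * sqrt (real n / ln (real n)) + 1 < (z n - 1) * (138 / 100)"
    unfolding z_def by real_asymp
  have 4: "\<forall>\<^sub>F n in sequentially. M n > 0"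
    by (rule eventually_compose_filterlim[OF eventually_gt_at_top limM])
  show ?thesis using 1 2 3 4 eventually_gt_at_top[of 0]
  proof eventually_elim
    case (elim n)
    have z: "real (M n) \<le> z n" "z n - 1 < real (M n)"
      using elim(4) unfolding M_def by linarith+
    have "(real (M n) ^ 2 / 2 + (real K + 3) * real (M n)) * (101 / 69 * ln (real (M n)))
       \<le> (z n ^ 2 / 2 + (real K + 3) * z n) * (101 / 69 * ln (z n))"
      using z elim(4) by (intro mult_mono add_mono divide_right_mono power_mono ln_mono) auto
    moreover have "3 * ((z n ^ 2 / 2 + (real K + 3) * z n) * (101 / 69 * ln (z n))) + 2 * real N\<^sub>0 < 2 * real n"
      using elim(2,5) by (simp add: divide_less_eq)
    ultimately have "3 * real (\<Sum>k<M n. large_prime K k) + 2 * real N\<^sub>0 \<le> 2 * real n"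
      using elim(1) by linarith
    then have "4 ^ M n \<le> 2 * card (A n)"
      using KN[of n "M n"] elim(5) by linarith
    then have c: "4 ^ M n \<le> 2 * real (card (A n))"
      by (metis of_nat_le_iff of_nat_mult of_nat_numeral of_nat_power)
    have "2 * exp (182 / 100 * sqrt (real n / ln (real n))) < exp (182 / 100 * sqrt (real n / ln (real n)) + 1)"
      using ln_2_less_1 exp_less_cancel_iff[of "ln 2" "1::real"] by (simp add: exp_add mult.commute)
    also have "\<dots> \<le> exp ((z n - 1) * (138 / 100))" using elim(3) by simp
    also have "\<dots> \<le> exp (real (M n) * (2 * ln 2))"
      using z ln_2_ge by (intro exp_mono mult_mono) auto
    also have "\<dots> = (exp (ln 2) ^ 2) ^ M n"
      by (simp only: exp_of_nat_mult[symmetric]) (simp add: exp_of_nat_mult)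
    also have "\<dots> = 4 ^ M n" by simp
    finally show ?case using c by linarith
  qed
qed

theorem theorem4:
  fixes c :: real
  assumes "c = pi / sqrt 3"
  shows "(\<forall>\<eta>::real. \<eta> > 0 \<longrightarrow> (\<forall>\<^sub>F n::nat in sequentially.
            exp ((c - \<eta>) * sqrt (real n / ln (real n))) < real (card (A n))))
       \<and> (\<forall>n::nat. n > 0 \<longrightarrow>
            card (A n) \<le> card (B n) \<and> real (card (B n)) < exp (c * sqrt (real n)))"
proof (intro conjI allI impI)
  fix \<eta> :: real
  assume "\<eta> > 0"
  \<comment> \<open>The constant pi / sqrt 3 is about 1.814, so the exponent in
    \<open>card_A_gt\<close> dominates; squaring removes the root.\<close>
  have "(pi / sqrt 3)\<^sup>2 \<le> (182 / 100)\<^sup>2"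
  proof -
    have "pi\<^sup>2 \<le> 3.1416\<^sup>2" using pi_approx by (intro power_mono) auto
    then show ?thesis by (simp add: power_divide power2_eq_square)
  qed
  then have c: "c \<le> 182 / 100" unfolding assms by (rule power2_le_imp_le) simp
  show "\<forall>\<^sub>F n in sequentially. exp ((c - \<eta>) * sqrt (real n / ln (real n))) < real (card (A n))"
    using card_A_gt eventually_gt_at_top[of 1]
  proof eventually_elim
    case (elim n)
    have "exp ((c - \<eta>) * sqrt (real n / ln (real n))) \<le> exp (182 / 100 * sqrt (real n / ln (real n)))"
      using c \<open>\<eta> > 0\<close> elim(2) by (intro exp_mono mult_right_mono) auto
    then show ?case using elim(1) by linarith
  qed
next
  fix n :: nat
  assume "n > 0"
  show "card (A n) \<le> card (B n)" by (intro card_mono finite_B A_subset_B)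
  show "real (card (B n)) < exp (c * sqrt (real n))"
    using card_B_less[OF \<open>n > 0\<close>] by (simp add: assms)
qed

end
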